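(* Let $\mathcal{X}\subset\mathbb{R}^d$ be the unit Euclidean ball centered at the origin and $\mathcal{Y}=[0,1]$. Suppose the nonparametric online regression algorithm (described in the context) is run with a positive definite $d\times d$ matrix $M$ with orthonormal eigenbasis $u_1,\dots,u_d$ and corresponding eigenvalues $1=\lambda_1\ge\cdots\ge\lambda_d>0$. Then, for every sequence $(x_1,y_1),(x_2,y_2),\dots\in\mathcal{X}\times\mathcal{Y}$, every $T\ge 1$, and every differentiable $f:\mathcal{X}\to\mathcal{Y}$, $$R_T(f)=\widetilde{O}\left(\left(\sqrt{\mathrm{det}_{\kappa}(M)}+\sqrt{\sum_{i=1}^d\frac{\|\nabla_{u_i}f\|_\infty^2}{\lambda_i}}\right)T^{\frac{\rho_T}{1+\rho_T}}\right),$$ where $\rho_T$ is the effective rank of $M$ at horizon $T$ and $\kappa=\kappa(\rho_T,T)\le\rho_T\le d$.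
   Context: Online protocol: an unknown sequence $(x_1,y_1),(x_2,y_2),\dots\in\mathcal{X}\times\mathcal{Y}$ is fixed in advance. At each round $t=1,2,\dots$ the learner observes $x_t$, outputs a prediction $\hat y_t\in\mathcal{Y}$, incurs loss $\ell_t(\hat y_t)=(\hat y_t-y_t)^2$, and then observes $y_t$. The regret against $f:\mathcal{X}\to\mathcal{Y}$ is $R_T(f)=\sum_{t=1}^T\big(\ell_t(\hat y_t)-\ell_t(f(x_t))\big)$. Notation: $\|x\|_M=\sqrt{x^\top Mx}$. For a unit vector $u$, $\|\nabla_u f\|_\infty=\max_{v\in\mathrm{span}(u),\,\|v\|=1}\ \sup_{x\in\mathcal{X}}\nabla f(x)^\top v$ (that is, $\sup_{x\in\mathcal X}|\nabla f(x)^\top u|$). The truncated determinant is $\mathrm{det}_k(M)=\lambda_1\lambda_2\cdots\lambda_k$. For $t\ge 1$ and $r\in\{1,\dots,d\}$, $\kappa(r,t)=\max\{m\in\{1,\dots,d\}:\lambda_m\ge t^{-2/(1+r)}\}$. The effective rank of $M$ at horizon $t$ is $\rho_t=\min\{r\in\{1,\dots,d\}:\kappa(r,t)\le r\}$. Algorithm (input: $M$). It maintains a set $S$ of center indices, initially empty, and for each $s\in S$ a set $T_s$ of time indices. At round $t=1,2,\dots$: 1. Set $\varepsilon_t=t^{-1/(1+\rho_t)}$ and observe $x_t$. 2. If $S=\varnothing$, set $S=\{t\}$ and $T_t=\varnothing$. 3. Let $s\in\arg\min_{s'\in S}\|x_t-x_{s'}\|_M$ (ties broken arbitrarily). 4.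 Predict $\hat y_t=\tfrac12$ if $T_s=\varnothing$, and $\hat y_t=\frac1{|T_s|}\sum_{t'\in T_s}y_{t'}$ otherwise. Then observe $y_t$. 5. If $\|x_t-x_s\|_M\le\varepsilon_t$, replace $T_s$ by $T_s\cup\{t\}$. Otherwise add $t$ to $S$ as a new center and set $T_t=\varnothing$. The notation $\widetilde{O}$ hides factors polylogarithmic in $T$ and multiplicative constants that may depend only on the dimension $d$ (not on $T$, $M$, $f$ or the data sequence). *)

theory Defs
  imports "HOL-Analysis.Analysis"
begin

definition mnorm :: "real^'d^'d \<Rightarrow> real^'d \<Rightarrow> real" where
  "mnorm M x = sqrt (x \<bullet> (M *v x))"

definition positive_definite :: "real^'d^'d \<Rightarrow> bool" where
  "positive_definite M \<longleftrightarrow> transpose M = M \<and> (\<forall>x. x \<noteq> 0 \<longrightarrow> 0 < x \<bullet> (M *v x))"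

text \<open>Eigenvalues and eigenvectors are indexed by \<open>1, \<dots>, d\<close> where \<open>d = CARD('d)\<close>;
  values at other indices are irrelevant.  The eigenvalues are
  \<open>1 = lam 1 \<ge> \<dots> \<ge> lam d > 0\<close>, so \<open>lam\<close> is determined by \<open>M\<close> on \<open>{1..d}\<close>.\<close>

definition normalized_eigensystem ::
    "real^'d^'d \<Rightarrow> (nat \<Rightarrow> real^'d) \<Rightarrow> (nat \<Rightarrow> real) \<Rightarrow> bool" where
  "normalized_eigensystem M u lam \<longleftrightarrow>
     (\<forall>i\<in>{1..CARD('d)}. \<forall>j\<in>{1..CARD('d)}. u i \<bullet> u j = (if i = j then 1 else 0)) \<and>
     (\<forall>i\<in>{1..CARD('d)}. M *v u i = lam i *\<^sub>R u i) \<and>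
     lam 1 = 1 \<and>
     (\<forall>i\<in>{1..CARD('d)}. \<forall>j\<in>{1..CARD('d)}. i \<le> j \<longrightarrow> lam j \<le> lam i) \<and>
     0 < lam CARD('d)"

definition truncated_det :: "(nat \<Rightarrow> real) \<Rightarrow> nat \<Rightarrow> real" where
  "truncated_det lam k = (\<Prod>i=1..k. lam i)"

definition kappa :: "nat \<Rightarrow> (nat \<Rightarrow> real) \<Rightarrow> nat \<Rightarrow> nat \<Rightarrow> nat" where
  "kappa d lam r t = Max {m \<in> {1..d}. lam m \<ge> real t powr (- 2 / (1 + real r))}"

definition effective_rank :: "nat \<Rightarrow> (nat \<Rightarrow> real) \<Rightarrow> nat \<Rightarrow> nat" where
  "effective_rank d lam t = Min {r \<in> {1..d}. kappa d lam r t \<le> r}"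

definition radius :: "nat \<Rightarrow> (nat \<Rightarrow> real) \<Rightarrow> nat \<Rightarrow> real" where
  "radius d lam t = real t powr (- 1 / (1 + real (effective_rank d lam t)))"

text \<open>Differentiability at a boundary point is relative to the ball.  The ball is convex with
  nonempty interior, so the derivative there is still unique; see
  \<open>has_derivative_grad_unique\<close> below.\<close>

definition grad :: "(real^'d \<Rightarrow> real) \<Rightarrow> real^'d \<Rightarrow> real^'d" where
  "grad f x = (\<chi> i. frechet_derivative f (at x within cball 0 1) (axis i 1))"

text \<open>A differentiable function on the ball may have an unbounded gradient, hence the
  extended-real value.\<close>

definition grad_sup_norm :: "real^'d \<Rightarrow> (real^'d \<Rightarrow> real) \<Rightarrow> ereal" where
  "grad_sup_norm u f =
     (SUP v\<in>{v \<in> span {u}. norm v = 1}. SUP x\<in>cball 0 1. ereal (grad f x \<bullet> v))"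

definition ereal_sqrt :: "ereal \<Rightarrow> ereal" where
  "ereal_sqrt a = (case a of ereal r \<Rightarrow> ereal (sqrt r) | PInfty \<Rightarrow> \<infinity> | MInfty \<Rightarrow> -\<infinity>)"

lemma has_derivative_frechet_unit_ball_unique:
  fixes f :: "real^'d \<Rightarrow> real"
  assumes D: "(f has_derivative D) (at x within cball 0 1)"
    and E: "(f has_derivative E) (at x within cball 0 1)"
    and x: "x \<in> cball 0 1"
  shows "D = E"
proof
  fix h :: "real^'d"
  interpret D: bounded_linear D using D by (rule has_derivative_bounded_linear)
  interpret E: bounded_linear E using E by (rule has_derivative_bounded_linear)
  have eq: "D (z - x) = E (z - x)" if z: "z \<in> cball 0 1" for z
  proof -
    let ?g = "\<lambda>t::real. x + t *\<^sub>R (z - x)"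
    have seg: "?g ` {0..1} \<subseteq> cball 0 1"
    proof clarify
      fix t :: real assume t: "t \<in> {0..1}"
      have "(1 - t) *\<^sub>R x + t *\<^sub>R z \<in> cball 0 1"
        using t x z by (intro convexD) auto
      then show "?g t \<in> cball 0 1" by (simp add: algebra_simps)
    qed
    have g: "(?g has_derivative (\<lambda>t. t *\<^sub>R (z - x))) (at 0 within {0..1})"
      by (auto intro!: derivative_eq_intros)
    have comp: "((\<lambda>t. f (?g t)) has_vector_derivative F (z - x)) (at 0 within {0..1})"
      if F: "(f has_derivative F) (at x within cball 0 1)" for F
    proof -
      interpret F: bounded_linear F using F by (rule has_derivative_bounded_linear)
      have "(f has_derivative F) (at (?g 0) within ?g ` {0..1})"
        using has_derivative_subset[OF F seg] by simp
      from diff_chain_within[OF g this] show ?thesis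
        by (simp add: has_vector_derivative_def o_def F.scaleR)
    qed
    show ?thesis
      by (rule vector_derivative_unique_within[OF _ comp[OF D] comp[OF E]])
        (simp add: trivial_limit_within islimpt_Icc)
  qed
  show "D h = E h"
  proof (cases "h = 0")
    case False
    define w where "w = (1 / norm h) *\<^sub>R h"
    have "w \<in> cball 0 1" "(0::real^'d) \<in> cball 0 1" using False by (auto simp: w_def)
    from eq[OF this(1)] eq[OF this(2)] have "D w = E w"
      by (simp add: D.diff E.diff D.zero E.zero D.neg E.neg)
    then show ?thesis using False by (simp add: w_def D.scaleR E.scaleR)
  qed (simp add: D.zero E.zero D.neg E.neg)
qed

lemma has_derivative_grad_unique:
  fixes f :: "real^'d \<Rightarrow> real"
  assumes D: "(f has_derivative D) (at x within cball 0 1)" and x: "x \<in> cball 0 1"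
  shows "D h = grad f x \<bullet> h"
proof -
  have "(f has_derivative frechet_derivative f (at x within cball 0 1)) (at x within cball 0 1)"
    using D by (auto simp: frechet_derivative_works[symmetric] differentiable_def)
  from has_derivative_frechet_unit_ball_unique[OF this D x]
  have eq: "frechet_derivative f (at x within cball 0 1) = D" .
  have lin: "linear D" using D by (rule has_derivative_linear)
  have "D h = D (\<Sum>i\<in>UNIV. (h $ i) *\<^sub>R axis i 1)"
    by (simp add: basis_expansion scalar_mult_eq_scaleR[symmetric])
  also have "\<dots> = (\<Sum>i\<in>UNIV. h $ i * D (axis i 1))"
    using lin by (simp add: linear_sum linear_cmul)
  finally show ?thesis by (simp add: grad_def eq inner_vec_def mult.commute)
qed

record nn_state =
  centers :: "nat set"
  cell :: "nat \<Rightarrow> nat set"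

definition ensure_center :: "nat \<Rightarrow> nn_state \<Rightarrow> nn_state" where
  "ensure_center t st =
     (if centers st = {} then \<lparr>centers = {t}, cell = (cell st)(t := {})\<rparr> else st)"

definition predict :: "(nat \<Rightarrow> real) \<Rightarrow> nn_state \<Rightarrow> nat \<Rightarrow> real" where
  "predict y st s =
     (if cell st s = {} then 1 / 2 else (\<Sum>t'\<in>cell st s. y t') / real (card (cell st s)))"

definition update ::
    "(nat \<Rightarrow> real) \<Rightarrow> real^'d^'d \<Rightarrow> (nat \<Rightarrow> real^'d) \<Rightarrow> nat \<Rightarrow> nat \<Rightarrow> nn_state \<Rightarrow> nn_state" where
  "update eps M x t s st =
     (if mnorm M (x t - x s) \<le> eps t
      then st\<lparr>cell := (cell st)(s := cell st s \<union> {t})\<rparr>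
      else \<lparr>centers = centers st \<union> {t}, cell = (cell st)(t := {})\<rparr>)"

text \<open>The sequence \<open>sel\<close> records the center selected in each round; it is kept as a parameter
  so that a statement quantified over all valid \<open>sel\<close> covers every way of breaking ties.
  \<open>state_after \<dots> n\<close> is the state after \<open>n\<close> rounds, \<open>state_in \<dots> t\<close> the state
  in round \<open>t\<close> when the center is selected and the prediction is made.\<close>

primrec state_after ::
    "(nat \<Rightarrow> real) \<Rightarrow> real^'d^'d \<Rightarrow> (nat \<Rightarrow> real^'d) \<Rightarrow> (nat \<Rightarrow> nat) \<Rightarrow> nat \<Rightarrow> nn_state" where
  "state_after eps M x sel 0 = \<lparr>centers = {}, cell = (\<lambda>_. {})\<rparr>"
| "state_after eps M x sel (Suc n) =
     update eps M x (Suc n) (sel (Suc n)) (ensure_center (Suc n) (state_after eps M x sel n))"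

definition state_in ::
    "(nat \<Rightarrow> real) \<Rightarrow> real^'d^'d \<Rightarrow> (nat \<Rightarrow> real^'d) \<Rightarrow> (nat \<Rightarrow> nat) \<Rightarrow> nat \<Rightarrow> nn_state" where
  "state_in eps M x sel t = ensure_center t (state_after eps M x sel (t - 1))"

definition valid_selection ::
    "(nat \<Rightarrow> real) \<Rightarrow> real^'d^'d \<Rightarrow> (nat \<Rightarrow> real^'d) \<Rightarrow> (nat \<Rightarrow> nat) \<Rightarrow> bool" where
  "valid_selection eps M x sel \<longleftrightarrow>
     (\<forall>t\<ge>1. is_arg_min (\<lambda>s. mnorm M (x t - x s))
              (\<lambda>s. s \<in> centers (state_in eps M x sel t)) (sel t))"

definition prediction ::
    "(nat \<Rightarrow> real) \<Rightarrow> real^'d^'d \<Rightarrow> (nat \<Rightarrow> real^'d) \<Rightarrow> (nat \<Rightarrow> real) \<Rightarrow> (nat \<Rightarrow> nat) \<Rightarrow> nat \<Rightarrow> real"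
  where
  "prediction eps M x y sel t = predict y (state_in eps M x sel t) (sel t)"

definition regret ::
    "(nat \<Rightarrow> real) \<Rightarrow> (nat \<Rightarrow> 'a) \<Rightarrow> (nat \<Rightarrow> real) \<Rightarrow> ('a \<Rightarrow> real) \<Rightarrow> nat \<Rightarrow> real" where
  "regret yhat x y f T = (\<Sum>t=1..T. (yhat t - y t)\<^sup>2 - (f (x t) - y t)\<^sup>2)"

end

(*
The effective rank is nondecreasing in t, so the radii up to T are at most t^(-1/(1+rho)), with
sum of order T^(rho/(1+rho)), and f is Lipschitz with respect to the M-norm with constant
sqrt (sum_i |grad_i f|^2 / lam_i) by the mean value theorem and Cauchy-Schwarz.  On each cell the
running mean competes with the constant f(x_s) up to an additive O(log T), and every new center
costs at most 1.  It remains to count the centers: they are pairwise further apart than the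
smallest radius used so far, and a grid argument in the eigenbasis bounds such a packing of the
ball by the volume ratio of the corresponding ellipsoid.
*)
theory Submission
  imports Defs
begin

subsection \<open>The norm of the algorithm in an eigenbasis\<close>

text \<open>The exponent is a balance. For eps = T^(-1/(1+rho)) both T * eps and eps^(-rho) equal
  T^(rho/(1+rho)); the former governs the approximation error, weighted by the Lipschitz constant,
  the latter the number of centers, weighted by the square root of the truncated determinant. In the
  coordinates \<open>sqrt (lam i) * (w \<bullet> u i)\<close> the norm of the algorithm is Euclidean
  and the unit ball is an ellipsoid with semi-axes \<open>sqrt (lam i)\<close>. The threshold in
  \<open>kappa\<close> is eps^2, so the semi-axes up to index kappa are those of length at least
  eps; each contributes a factor \<open>sqrt (lam i)\<close> / eps to the count, every other axis
  only a constant. The inequality kappa <= rho then turns eps^(-kappa) into eps^(-rho). The obstacle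
  is that eps can increase when the effective rank jumps, so the final radius does not control the
  separation of the centers.\<close>

lemma eigenvalue_bounds:
  assumes "normalized_eigensystem (M :: real^'d^'d) u lam" and "i \<in> {1..CARD('d)}"
  shows "0 < lam i" and "lam i \<le> 1"
proof -
  have "lam CARD('d) \<le> lam i"
    using assms unfolding normalized_eigensystem_def by simp
  then show "0 < lam i"
    using assms(1) unfolding normalized_eigensystem_def by linarith
  have "1 \<in> {1..CARD('d)}" "1 \<le> i" using assms(2) by auto
  then show "lam i \<le> 1" using assms unfolding normalized_eigensystem_def by metis
qed

lemma eigenbasis_expansion:
  assumes E: "normalized_eigensystem (M :: real^'d^'d) u lam"
  shows "w = (\<Sum>i=1..CARD('d). (w \<bullet> u i) *\<^sub>R u i)"
proof -
  let ?I = "{1..CARD('d)}"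
  have on: "u i \<bullet> u j = (if i = j then 1 else 0)" if "i \<in> ?I" "j \<in> ?I" for i j
    using E that unfolding normalized_eigensystem_def by blast
  have inj: "inj_on u ?I"
    by (rule inj_onI) (metis on zero_neq_one)
  have orth: "pairwise orthogonal (u ` ?I)"
    unfolding pairwise_def orthogonal_def using on by force
  have norm1: "norm v = 1" if "v \<in> u ` ?I" for v
    using that on by (auto simp: norm_eq_sqrt_inner)
  have "0 \<notin> u ` ?I" using norm1 by force
  then have "independent (u ` ?I)" using orth by (rule pairwise_orthogonal_independent[rotated])
  moreover have "card (u ` ?I) = dim (UNIV :: (real^'d) set)"
    using inj by (simp add: card_image dim_UNIV)
  ultimately have "UNIV \<subseteq> span (u ` ?I)"
    by (intro iffD1[OF card_eq_dim]) auto
  then have "w \<in> span (u ` ?I)" by auto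
  then have "(\<Sum>i\<in>u ` ?I. (w \<bullet> i) *\<^sub>R i) = w"
    using orth norm1 by (intro orthonormal_basis_expand) auto
  then show ?thesis using inj by (simp add: sum.reindex)
qed

lemma mnorm_eigenbasis:
  assumes E: "normalized_eigensystem (M :: real^'d^'d) u lam"
  shows "mnorm M w = sqrt (\<Sum>i=1..CARD('d). lam i * (w \<bullet> u i)\<^sup>2)"
proof -
  have "M *v w = M *v (\<Sum>i=1..CARD('d). (w \<bullet> u i) *\<^sub>R u i)"
    using eigenbasis_expansion[OF E, of w] by simp
  also have "\<dots> = (\<Sum>i=1..CARD('d). (w \<bullet> u i) *\<^sub>R (M *v u i))"
    by (simp add: linear_sum[OF matrix_vector_mul_linear]
        linear_cmul[OF matrix_vector_mul_linear])
  also have "\<dots> = (\<Sum>i=1..CARD('d). (w \<bullet> u i) *\<^sub>R lam i *\<^sub>R u i)"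
    using E unfolding normalized_eigensystem_def by (intro sum.cong) auto
  finally show ?thesis
    by (simp add: mnorm_def inner_sum_right power2_eq_square mult.commute mult.left_commute)
qed

lemma mnorm_minus_commute: "mnorm M (a - b) = mnorm M (b - a)"
proof -
  have "(a - b) \<bullet> (M *v (a - b)) = (b - a) \<bullet> (M *v (b - a))"
    by (simp add: matrix_vector_mult_diff_distrib inner_diff_left inner_diff_right)
  then show ?thesis by (simp add: mnorm_def)
qed

section \<open>Lipschitz continuity in the norm of the algorithm\<close>

lemma differentiable_on_ball_mvt:
  fixes f :: "real^'d \<Rightarrow> real"
  assumes f: "f differentiable_on cball 0 1" and ab: "a \<in> cball 0 1" "b \<in> cball 0 1"
  obtains z where "z \<in> cball 0 1" "f a - f b = grad f z \<bullet> (a - b)"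
proof -
  let ?g = "\<lambda>t::real. b + t *\<^sub>R (a - b)"
  have seg: "?g t \<in> cball 0 1" if "t \<in> {0..1}" for t
  proof -
    have "(1 - t) *\<^sub>R b + t *\<^sub>R a \<in> cball 0 1"
      using that ab by (intro convexD) auto
    then show ?thesis by (simp add: algebra_simps)
  qed
  have D: "((\<lambda>t. f (?g t)) has_derivative (\<lambda>h. h * (grad f (?g t) \<bullet> (a - b)))) (at t within {0..1})"
    if t: "0 \<le> t" "t \<le> 1" for t
  proof -
    obtain D where D: "(f has_derivative D) (at (?g t) within cball 0 1)"
      using f seg[of t] t unfolding differentiable_on_def differentiable_def
      by (metis atLeastAtMost_iff)
    have eq: "D = (\<lambda>h. grad f (?g t) \<bullet> h)"
      using has_derivative_grad_unique[OF D] seg[of t] t by auto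
    have g: "(?g has_derivative (\<lambda>h. h *\<^sub>R (a - b))) (at t within {0..1})"
      by (auto intro!: derivative_eq_intros)
    \<comment> \<open>Derivatives are taken within the ball, which covers endpoints on the sphere;
      restricting them to the segment is what the chain rule needs.\<close>
    have "(f has_derivative D) (at (?g t) within ?g ` {0..1})"
      using D seg by (rule_tac has_derivative_subset) auto
    from diff_chain_within[OF g this] show ?thesis by (simp add: o_def eq)
  qed
  obtain t where "t \<in> {0..1}" "f (?g 1) - f (?g 0) = (1 - 0) * (grad f (?g t) \<bullet> (a - b))"
    using mvt_very_simple[of 0 1 "\<lambda>t. f (?g t)", OF _ D] by auto
  then show ?thesis using that[of "?g t"] seg by auto
qed

lemma lipschitz_mnorm:
  fixes f :: "real^'d \<Rightarrow> real"
  assumes E: "normalized_eigensystem M u lam"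
    and f: "f differentiable_on cball 0 1"
    and g: "\<And>i z. i \<in> {1..CARD('d)} \<Longrightarrow> z \<in> cball 0 1 \<Longrightarrow> \<bar>grad f z \<bullet> u i\<bar> \<le> g i"
    and ab: "a \<in> cball 0 1" "b \<in> cball 0 1"
  shows "\<bar>f a - f b\<bar> \<le> sqrt (\<Sum>i=1..CARD('d). (g i)\<^sup>2 / lam i) * mnorm M (a - b)"
proof -
  let ?I = "{1..CARD('d)}" and ?w = "a - b"
  obtain z where z: "z \<in> cball 0 1" "f a - f b = grad f z \<bullet> ?w"
    using differentiable_on_ball_mvt[OF f ab] .
  have "grad f z \<bullet> ?w = (\<Sum>i\<in>?I. (?w \<bullet> u i) * (grad f z \<bullet> u i))"
    by (subst eigenbasis_expansion[OF E, of ?w]) (simp add: inner_sum_right)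
  then have "\<bar>f a - f b\<bar> \<le> (\<Sum>i\<in>?I. \<bar>?w \<bullet> u i\<bar> * \<bar>grad f z \<bullet> u i\<bar>)"
    using sum_abs[of "\<lambda>i. (?w \<bullet> u i) * (grad f z \<bullet> u i)" ?I] z(2) by (simp add: abs_mult)
  \<comment> \<open>Inserting \<open>sqrt (lam i)\<close> and its inverse before Cauchy-Schwarz
    makes the second factor exactly \<open>mnorm M ?w\<close>.\<close>
  also have "\<dots> \<le> (\<Sum>i\<in>?I. \<bar>g i / sqrt (lam i)\<bar> * \<bar>sqrt (lam i) * (?w \<bullet> u i)\<bar>)"
  proof (rule sum_mono)
    fix i assume i: "i \<in> ?I"
    have "\<bar>?w \<bullet> u i\<bar> * \<bar>grad f z \<bullet> u i\<bar> \<le> \<bar>?w \<bullet> u i\<bar> * g i"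
      using g[OF i z(1)] by (intro mult_left_mono) auto
    also have "\<dots> \<le> \<bar>?w \<bullet> u i\<bar> * \<bar>g i\<bar>"
      by (intro mult_left_mono) auto
    also have "\<dots> = \<bar>g i / sqrt (lam i)\<bar> * \<bar>sqrt (lam i) * (?w \<bullet> u i)\<bar>"
      using eigenvalue_bounds(1)[OF E i] by (simp add: abs_mult)
    finally show "\<bar>?w \<bullet> u i\<bar> * \<bar>grad f z \<bullet> u i\<bar>
        \<le> \<bar>g i / sqrt (lam i)\<bar> * \<bar>sqrt (lam i) * (?w \<bullet> u i)\<bar>" .
  qed
  also have "\<dots> \<le> L2_set (\<lambda>i. g i / sqrt (lam i)) ?I * L2_set (\<lambda>i. sqrt (lam i) * (?w \<bullet> u i)) ?I"
    by (rule L2_set_mult_ineq)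
  also have "L2_set (\<lambda>i. g i / sqrt (lam i)) ?I = sqrt (\<Sum>i\<in>?I. (g i)\<^sup>2 / lam i)"
    unfolding L2_set_def using eigenvalue_bounds(1)[OF E]
    by (intro arg_cong[of _ _ sqrt] sum.cong) (auto simp: power_divide less_imp_le)
  also have "L2_set (\<lambda>i. sqrt (lam i) * (?w \<bullet> u i)) ?I = mnorm M ?w"
    unfolding L2_set_def mnorm_eigenbasis[OF E] using eigenvalue_bounds(1)[OF E]
    by (intro arg_cong[of _ _ sqrt] sum.cong) (auto simp: power_mult_distrib less_imp_le)
  finally show ?thesis .
qed

section \<open>Packing the unit ball\<close>

lemma card_floor_range_le:
  assumes "0 \<le> (K::real)"
  shows "real (card {\<lfloor>- K\<rfloor>..\<lfloor>K\<rfloor>}) \<le> 2 * K + 2"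
  using assms by simp linarith

text \<open>Pigeonhole on the grid of mesh \<open>\<epsilon> / sqrt (d * lam i)\<close> in the direction \<open>u i\<close>.\<close>

lemma packing_bound:
  fixes M :: "real^'d^'d" and x :: "'i \<Rightarrow> real^'d"
  assumes E: "normalized_eigensystem M u lam" and eps: "0 < \<epsilon>"
    and ball: "\<And>s. s \<in> S \<Longrightarrow> x s \<in> cball 0 1"
    and sep: "\<And>s s'. s \<in> S \<Longrightarrow> s' \<in> S \<Longrightarrow> s \<noteq> s' \<Longrightarrow> \<epsilon> < mnorm M (x s - x s')"
  shows "real (card S) \<le> (2 * sqrt (real CARD('d)) + 2) ^ CARD('d) *
           (\<Prod>i=1..CARD('d). max 1 (sqrt (lam i) / \<epsilon>))"
proof -
  let ?d = "CARD('d)" and ?I = "{1..CARD('d)}"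
  define K where "K i = sqrt (lam i) * sqrt ?d / \<epsilon>" for i
  define G where "G s = restrict (\<lambda>i. \<lfloor>(x s \<bullet> u i) * K i\<rfloor>) ?I" for s
  have pos: "0 < lam i" if "i \<in> ?I" for i using eigenvalue_bounds(1)[OF E that] .
  have Kpos: "0 < K i" if "i \<in> ?I" for i using pos[OF that] eps by (simp add: K_def)
  have norm_u: "norm (u i) = 1" if "i \<in> ?I" for i
    using E that unfolding normalized_eigensystem_def by (auto simp: norm_eq_sqrt_inner)
  let ?R = "\<lambda>i. {\<lfloor>- K i\<rfloor>..\<lfloor>K i\<rfloor>}"
  have "inj_on G S"
  proof (rule inj_onI, rule ccontr)
    fix s s' assume s: "s \<in> S" "s' \<in> S" "G s = G s'" "s \<noteq> s'"
    let ?w = "x s - x s'"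
    \<comment> \<open>Points of the same grid cell differ by at most \<open>1 / K i\<close> in
      coordinate \<open>i\<close>. The factor \<open>sqrt d\<close> in \<open>K\<close> gives each
      of the \<open>d\<close> coordinates an equal share of the squared distance.\<close>
    have "lam i * (?w \<bullet> u i)\<^sup>2 \<le> \<epsilon>\<^sup>2 / ?d" if i: "i \<in> ?I" for i
    proof -
      have "\<lfloor>(x s \<bullet> u i) * K i\<rfloor> = \<lfloor>(x s' \<bullet> u i) * K i\<rfloor>"
        using fun_cong[OF s(3), of i] i by (simp add: G_def)
      then have "\<bar>(x s \<bullet> u i) * K i - (x s' \<bullet> u i) * K i\<bar> \<le> 1" by linarith
      then have "\<bar>(?w \<bullet> u i) * K i\<bar> \<le> 1" by (simp add: inner_diff_left left_diff_distrib)
      then have "((?w \<bullet> u i) * K i)\<^sup>2 \<le> 1" by (simp add: abs_square_le_1)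
      moreover have "((?w \<bullet> u i) * K i)\<^sup>2 = (lam i * (?w \<bullet> u i)\<^sup>2) * (?d / \<epsilon>\<^sup>2)"
        using pos[OF i] by (simp add: K_def power_mult_distrib power_divide)
      ultimately have "(lam i * (?w \<bullet> u i)\<^sup>2) * (?d / \<epsilon>\<^sup>2) \<le> 1" by simp
      then show ?thesis using eps by (simp add: field_simps)
    qed
    then have "(\<Sum>i\<in>?I. lam i * (?w \<bullet> u i)\<^sup>2) \<le> (\<Sum>i\<in>?I. \<epsilon>\<^sup>2 / ?d)"
      by (rule sum_mono)
    also have "\<dots> = \<epsilon>\<^sup>2" by simp
    finally have "mnorm M ?w \<le> \<epsilon>"
      unfolding mnorm_eigenbasis[OF E] using eps by (intro real_le_lsqrt) auto
    then show False using sep[OF s(1,2,4)] by simp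
  qed
  moreover have "G ` S \<subseteq> (\<Pi>\<^sub>E i\<in>?I. ?R i)"
  proof (rule image_subsetI)
    fix s assume s: "s \<in> S"
    have "\<lfloor>(x s \<bullet> u i) * K i\<rfloor> \<in> ?R i" if i: "i \<in> ?I" for i
    proof -
      have "\<bar>x s \<bullet> u i\<bar> \<le> norm (x s) * norm (u i)" by (rule Cauchy_Schwarz_ineq2)
      also have "\<dots> \<le> 1" using ball[OF s] norm_u[OF i] by simp
      finally have "\<bar>(x s \<bullet> u i) * K i\<bar> \<le> 1 * K i"
        unfolding abs_mult using Kpos[OF i] by (intro mult_mono) auto
      then show ?thesis by (auto intro!: floor_mono)
    qed
    then show "G s \<in> (\<Pi>\<^sub>E i\<in>?I. ?R i)" by (auto simp: G_def)
  qed
  ultimately have "card S \<le> card (\<Pi>\<^sub>E i\<in>?I. ?R i)"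
    by (intro card_inj_on_le finite_PiE) auto
  also have "\<dots> = (\<Prod>i\<in>?I. card (?R i))" by (rule card_PiE) simp
  finally have "real (card S) \<le> (\<Prod>i\<in>?I. real (card (?R i)))"
    by (metis of_nat_le_iff of_nat_prod)
  \<comment> \<open>Both summands of \<open>2 * K i + 2\<close> are compared with the same maximum;
    hence the constant \<open>2 * sqrt d + 2\<close> per coordinate.\<close>
  also have "\<dots> \<le> (\<Prod>i\<in>?I. (2 * sqrt ?d + 2) * max 1 (sqrt (lam i) / \<epsilon>))"
  proof (rule prod_mono, intro conjI)
    fix i assume i: "i \<in> ?I"
    have "real (card (?R i)) \<le> 2 * K i + 2"
      using Kpos[OF i] by (intro card_floor_range_le) simp
    also have "\<dots> = 2 * sqrt ?d * (sqrt (lam i) / \<epsilon>) + 2 * 1" by (simp add: K_def)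
    also have "\<dots> \<le> 2 * sqrt ?d * max 1 (sqrt (lam i) / \<epsilon>) + 2 * max 1 (sqrt (lam i) / \<epsilon>)"
      by (intro add_mono mult_left_mono) auto
    finally show "real (card (?R i)) \<le> (2 * sqrt ?d + 2) * max 1 (sqrt (lam i) / \<epsilon>)"
      by (simp add: distrib_right)
  qed simp
  also have "\<dots> = (2 * sqrt ?d + 2) ^ ?d * (\<Prod>i\<in>?I. max 1 (sqrt (lam i) / \<epsilon>))"
    by (simp add: prod.distrib)
  finally show ?thesis .
qed

subsection \<open>Effective rank and radii\<close>

lemma powr_rank_exponent_mono:
  assumes "1 \<le> t" "t \<le> T" "r \<le> R"
  shows "real t powr (real r / (1 + real r)) \<le> real T powr (real R / (1 + real R))"
proof -
  have "real t powr (real r / (1 + real r)) \<le> real T powr (real r / (1 + real r))"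
    using assms by (intro powr_mono2) auto
  also have "\<dots> \<le> real T powr (real R / (1 + real R))"
    using assms by (intro powr_mono) (auto simp: field_simps)
  finally show ?thesis .
qed

text \<open>A discrete integral comparison: with a = r/(1+r) and b = 1 - a, Young's inequality
  bounds T^a (T+1)^b by (T+1) - a, so (T+1)^a - T^a is at least a (T+1)^(-b). The factor 2 comes
  from a >= 1/2.\<close>

lemma sum_powr_rank_le:
  assumes r: "1 \<le> r"
  shows "(\<Sum>t=1..T. real t powr (- 1 / (1 + real r))) \<le> 2 * real T powr (real r / (1 + real r))"
proof -
  define a where "a = real r / (1 + real r)"
  define b where "b = 1 / (1 + real r)"
  have ab: "a + b = 1" "0 \<le> b" "1 / 2 \<le> a" using r by (auto simp: a_def b_def field_simps)
  have "(\<Sum>t=1..T. real t powr (- b)) \<le> 2 * real T powr a"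
  proof (induction T)
    case (Suc T)
    let ?t = "real (Suc T)"
    have "real T powr a * ?t powr b \<le> a * real T + b * ?t"
    proof (cases "T = 0")
      case False
      then show ?thesis using ab by (intro Youngs_inequality_0) auto
    qed (use ab in simp)
    also have "\<dots> = (a + b) * ?t - a" by (simp add: algebra_simps)
    also have "\<dots> = ?t - a" using ab(1) by simp
    finally have "real T powr a * ?t powr b * ?t powr (- b) \<le> (?t - a) * ?t powr (- b)"
      by (rule mult_right_mono) simp
    moreover have "?t powr b * ?t powr (- b) = 1" by (simp flip: powr_add)
    moreover have "?t * ?t powr (- b) = ?t powr a"
    proof -
      have "?t * ?t powr (- b) = ?t powr (1 + - b)" unfolding powr_add by simp
      also have "1 + - b = a" using ab by linarith
      finally show ?thesis .
    qed
    ultimately have "real T powr a \<le> ?t powr a - a * ?t powr (- b)"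
      by (simp only: mult.assoc left_diff_distrib mult_1_right)
    moreover have "1 / 2 * ?t powr (- b) \<le> a * ?t powr (- b)"
      using ab by (intro mult_right_mono) auto
    ultimately have "?t powr (- b) \<le> 2 * ?t powr a - 2 * real T powr a" by linarith
    then show ?case using Suc.IH by simp
  qed simp
  then show ?thesis by (simp add: a_def b_def)
qed

text \<open>Rank, radius and volume depend on the matrix only through its eigenvalues, so they are
  treated for a bare decreasing sequence.\<close>

locale normalized_spectrum =
  fixes d :: nat and lam :: "nat \<Rightarrow> real"
  assumes dec: "1 \<le> i \<Longrightarrow> i \<le> j \<Longrightarrow> j \<le> d \<Longrightarrow> lam j \<le> lam i"
    and lam1: "lam 1 = 1" and pos: "i \<in> {1..d} \<Longrightarrow> 0 < lam i" and d: "1 \<le> d"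
begin

text \<open>Since \<open>lam 1 = 1\<close> reaches every threshold, the maximum is over a nonempty
  set; since \<open>lam\<close> decreases, that set is an initial segment, and membership is
  comparison with \<open>kappa\<close>.\<close>

lemma kappa_props:
  assumes t: "1 \<le> t"
  shows "kappa d lam r t \<in> {1..d}"
    and "i \<in> {1..d} \<Longrightarrow> i \<le> kappa d lam r t \<longleftrightarrow> real t powr (- 2 / (1 + real r)) \<le> lam i"
proof -
  let ?A = "{m \<in> {1..d}. lam m \<ge> real t powr (- 2 / (1 + real r))}"
  have "real t powr (- 2 / (1 + real r)) \<le> real t powr 0"
    using t by (intro powr_mono) (auto simp: field_simps)
  then have "1 \<in> ?A" using d t lam1 by simp
  then have mem: "kappa d lam r t \<in> ?A" unfolding kappa_def by (intro Max_in) auto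
  then show "kappa d lam r t \<in> {1..d}" by blast
  assume i: "i \<in> {1..d}"
  show "i \<le> kappa d lam r t \<longleftrightarrow> real t powr (- 2 / (1 + real r)) \<le> lam i"
  proof
    assume "i \<le> kappa d lam r t"
    then have "lam (kappa d lam r t) \<le> lam i" using mem i by (intro dec) auto
    then show "real t powr (- 2 / (1 + real r)) \<le> lam i" using mem by simp
  next
    assume "real t powr (- 2 / (1 + real r)) \<le> lam i"
    then show "i \<le> kappa d lam r t" unfolding kappa_def using i by (intro Max_ge) auto
  qed
qed

lemma kappa_mono:
  assumes t: "1 \<le> t" and tT: "t \<le> T"
  shows "kappa d lam r t \<le> kappa d lam r T"
proof -
  have T: "1 \<le> T" using t tT by simp
  have "real T powr (- 2 / (1 + real r)) \<le> real t powr (- 2 / (1 + real r))"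
    using t tT by (intro powr_mono2') (auto simp: field_simps)
  also have "\<dots> \<le> lam (kappa d lam r t)"
    using kappa_props(2)[OF t kappa_props(1)[OF t, of r], of r] by simp
  finally show ?thesis using kappa_props(2)[OF T kappa_props(1)[OF t, of r], of r] by simp
qed

lemma effective_rank_props:
  assumes t: "1 \<le> t"
  shows "effective_rank d lam t \<in> {1..d}"
    and "kappa d lam (effective_rank d lam t) t \<le> effective_rank d lam t"
proof -
  have "d \<in> {r \<in> {1..d}. kappa d lam r t \<le> r}"
    using kappa_props(1)[OF t] d by simp
  then have "effective_rank d lam t \<in> {r \<in> {1..d}. kappa d lam r t \<le> r}"
    unfolding effective_rank_def by (intro Min_in) auto
  then show "effective_rank d lam t \<in> {1..d}"
    and "kappa d lam (effective_rank d lam t) t \<le> effective_rank d lam t" by auto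
qed

text \<open>The threshold falls with time, so for fixed \<open>r\<close> the cutoff index grows.
  Hence the rank at \<open>T\<close> is already admissible in the minimum at
  \<open>t\<close>.\<close>

lemma effective_rank_mono:
  assumes t: "1 \<le> t" and tT: "t \<le> T"
  shows "effective_rank d lam t \<le> effective_rank d lam T"
proof -
  have T: "1 \<le> T" using t tT by simp
  let ?R = "effective_rank d lam T"
  have "kappa d lam ?R t \<le> ?R"
    using kappa_mono[OF t tT] effective_rank_props(2)[OF T] le_trans by blast
  then show ?thesis
    unfolding effective_rank_def[of d lam t] using effective_rank_props(1)[OF T]
    by (intro Min_le) auto
qed

text \<open>The radii are not monotone in \<open>t\<close>, since the effective rank may jump up.  Hence the
  bound is needed at every \<open>t \<le> T\<close>, in terms of the determinant at \<open>T\<close> only: if the cutoff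
  index at \<open>t\<close> is at least that at \<open>T\<close>, then the extra factors are at most 1; otherwise the
  radius at \<open>t\<close> exceeds the one at \<open>T\<close>.\<close>

lemma ellipsoid_volume_bound:
  assumes t: "1 \<le> t" and tT: "t \<le> T" and R: "R = effective_rank d lam T"
  shows "(\<Prod>i=1..d. max 1 (sqrt (lam i) / radius d lam t))
    \<le> sqrt (truncated_det lam (kappa d lam R T)) * real T powr (real R / (1 + real R))"
proof -
  have T: "1 \<le> T" using t tT by simp
  define k where "k t = kappa d lam (effective_rank d lam t) t" for t
  have k_le: "k t \<in> {1..d}" "k t \<le> effective_rank d lam t" if "1 \<le> t" for t
    unfolding k_def using kappa_props(1)[OF that]
      effective_rank_props(2)[OF that] by auto
  have rad0: "0 < radius d lam t" if "1 \<le> t" for t using that by (simp add: radius_def)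
  have rad1: "radius d lam t \<le> 1" if "1 \<le> t" for t
  proof -
    have "radius d lam t \<le> real t powr 0"
      unfolding radius_def using that by (intro powr_mono) (auto simp: field_simps)
    then show ?thesis using that by simp
  qed
  \<comment> \<open>The squared radius is the threshold in \<open>kappa\<close>, so the cutoff
    separates the semi-axes at least as long as the radius from the shorter ones.\<close>
  have cut: "i \<le> k t \<longleftrightarrow> radius d lam t \<le> sqrt (lam i)" if "i \<in> {1..d}" "1 \<le> t" for i t
  proof -
    have "(radius d lam t)\<^sup>2 = real t powr (- 2 / (1 + real (effective_rank d lam t)))"
      using that(2) unfolding radius_def by (simp add: powr_powr flip: powr_numeral)
    then have "i \<le> k t \<longleftrightarrow> (radius d lam t)\<^sup>2 \<le> lam i"
      unfolding k_def using kappa_props(2)[OF that(2,1)] by simp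
    also have "\<dots> \<longleftrightarrow> radius d lam t \<le> sqrt (lam i)"
      using rad0[OF that(2)] pos[OF that(1)]
      by (metis less_imp_le real_le_rsqrt real_sqrt_le_iff real_sqrt_unique)
    finally show ?thesis .
  qed
  have volume: "(\<Prod>i=1..d. max 1 (sqrt (lam i) / radius d lam t))
      \<le> (\<Prod>i=1..k t. sqrt (lam i)) *
        real t powr (real (effective_rank d lam t) / (1 + real (effective_rank d lam t)))"
    if t: "1 \<le> t" for t
  proof -
    let ?e = "radius d lam t" and ?r = "effective_rank d lam t"
    have "(\<Prod>i=1..d. max 1 (sqrt (lam i) / ?e)) = (\<Prod>i=1..k t. sqrt (lam i) / ?e)"
    proof (rule prod.mono_neutral_cong_right)
      show "\<forall>i\<in>{1..d} - {1..k t}. max 1 (sqrt (lam i) / ?e) = 1"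
        using cut[OF _ t] rad0[OF t] by (force simp: field_simps)
      show "max 1 (sqrt (lam i) / ?e) = sqrt (lam i) / ?e" if "i \<in> {1..k t}" for i
      proof -
        have "i \<in> {1..d}" "i \<le> k t" using k_le(1)[OF t] that by auto
        then show ?thesis using cut[OF _ t] rad0[OF t] by (simp add: max_def field_simps)
      qed
    qed (use k_le(1)[OF t] in auto)
    also have "\<dots> = (\<Prod>i=1..k t. sqrt (lam i)) * (1 / ?e) ^ k t"
      by (simp add: prod_dividef power_divide)
    also have "\<dots> \<le> (\<Prod>i=1..k t. sqrt (lam i)) * (1 / ?e) ^ ?r"
    proof (rule mult_left_mono)
      show "(1 / ?e) ^ k t \<le> (1 / ?e) ^ ?r"
        using k_le(2)[OF t] rad0[OF t] rad1[OF t] by (intro power_increasing) auto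
      show "0 \<le> (\<Prod>i=1..k t. sqrt (lam i))"
        using pos k_le(1)[OF t] by (intro prod_nonneg) (auto simp: less_imp_le)
    qed
    also have "(1 / ?e) ^ ?r = real t powr (real ?r / (1 + real ?r))"
      using t unfolding radius_def
      by (simp add: powr_minus_divide powr_powr flip: powr_realpow)
    finally show ?thesis .
  qed
  have sqrt_prod: "sqrt (prod lam A) = (\<Prod>i\<in>A. sqrt (lam i))" for A
    by (induction A rule: infinite_finite_induct) (simp_all add: real_sqrt_mult)
  have det: "sqrt (truncated_det lam (k T)) = (\<Prod>i=1..k T. sqrt (lam i))"
    unfolding truncated_det_def by (rule sqrt_prod)
  have kR: "kappa d lam R T = k T" by (simp add: k_def R)
  show ?thesis
  proof (cases "k T \<le> k t")
    case True
    have "(\<Prod>i=1..k t. sqrt (lam i)) \<le> (\<Prod>i=1..k T. sqrt (lam i))"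
    proof -
      have le1: "sqrt (lam i) \<le> 1" if "i \<in> {1..d}" for i
        using dec[of 1 i] lam1 that by simp
      have "{1..k t} = {1..k T} \<union> {k T<..k t}" using True k_le(1)[OF T] by auto
      then have "(\<Prod>i=1..k t. sqrt (lam i))
          = (\<Prod>i=1..k T. sqrt (lam i)) * (\<Prod>i\<in>{k T<..k t}. sqrt (lam i))"
        by (simp only:) (subst prod.union_disjoint, auto)
      also have "\<dots> \<le> (\<Prod>i=1..k T. sqrt (lam i)) * 1"
        using pos k_le(1)[OF T] k_le(1)[OF t] le1
        by (intro mult_left_mono prod_le_1 prod_nonneg) (auto simp: less_imp_le)
      finally show ?thesis by simp
    qed
    moreover have "0 \<le> (\<Prod>i=1..k T. sqrt (lam i))"
      using pos k_le(1)[OF T] by (intro prod_nonneg) (auto simp: less_imp_le)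
    moreover have "real t powr (real (effective_rank d lam t) / (1 + real (effective_rank d lam t)))
        \<le> real T powr (real R / (1 + real R))"
      unfolding R by (rule powr_rank_exponent_mono[OF t tT effective_rank_mono[OF t tT]])
    ultimately show ?thesis
      unfolding kR det by (intro order_trans[OF volume[OF t]] mult_mono) auto
  next
    case False
    \<comment> \<open>The eigenvalue at index \<open>k T\<close> separates the two radii: it passes
      the cutoff at \<open>T\<close> and fails the one at \<open>t\<close>.\<close>
    have "k T \<in> {1..d}" using k_le(1)[OF T] .
    then have "radius d lam T \<le> sqrt (lam (k T))" "sqrt (lam (k T)) < radius d lam t"
      using cut[OF _ T, of "k T"] cut[OF _ t, of "k T"] False by auto
    then have le: "radius d lam T \<le> radius d lam t" by simp
    have "(\<Prod>i=1..d. max 1 (sqrt (lam i) / radius d lam t))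
        \<le> (\<Prod>i=1..d. max 1 (sqrt (lam i) / radius d lam T))"
      using rad0[OF T] pos le
      by (intro prod_mono conjI max.mono divide_left_mono) (auto simp: less_imp_le)
    then show ?thesis using volume[OF T] unfolding kR det R[symmetric] by linarith
  qed
qed

lemma sum_radius_le:
  assumes T: "1 \<le> T" and R: "R = effective_rank d lam T"
  shows "(\<Sum>t=1..T. radius d lam t) \<le> 2 * real T powr (real R / (1 + real R))"
proof -
  have "(\<Sum>t=1..T. radius d lam t) \<le> (\<Sum>t=1..T. real t powr (- 1 / (1 + real R)))"
  proof (rule sum_mono)
    fix t assume "t \<in> {1..T}"
    then have "1 \<le> t" "effective_rank d lam t \<le> R"
      unfolding R using effective_rank_mono by auto
    then show "radius d lam t \<le> real t powr (- 1 / (1 + real R))"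
      unfolding radius_def by (intro powr_mono) (auto simp: field_simps)
  qed
  also have "\<dots> \<le> 2 * real T powr (real R / (1 + real R))"
    using effective_rank_props(1)[OF T] R by (intro sum_powr_rank_le) auto
  finally show ?thesis .
qed

end

subsection \<open>The cells of the algorithm\<close>

text \<open>The squared deviations from the mean, expanded so that inserting a point changes two
  sums only. Division by zero yields 0 for the empty set.\<close>

definition sum_sq_dev :: "('i \<Rightarrow> real) \<Rightarrow> 'i set \<Rightarrow> real" where
  "sum_sq_dev y A = (\<Sum>t\<in>A. (y t)\<^sup>2) - (\<Sum>t\<in>A. y t)\<^sup>2 / real (card A)"

lemma sum_sq_dev_empty [simp]: "sum_sq_dev y {} = 0"
  by (simp add: sum_sq_dev_def)

lemma sum_sq_dev_le:
  assumes "finite A"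
  shows "sum_sq_dev y A \<le> (\<Sum>t\<in>A. (c - y t)\<^sup>2)"
proof (cases "A = {}")
  case False
  let ?n = "real (card A)" and ?S = "\<Sum>t\<in>A. y t"
  have n: "0 < ?n" using False assms by (simp add: card_gt_0_iff)
  have "(\<Sum>t\<in>A. (c - y t)\<^sup>2) = ?n * c\<^sup>2 - 2 * c * ?S + (\<Sum>t\<in>A. (y t)\<^sup>2)"
    by (simp add: power2_diff sum.distrib sum_subtractf sum_distrib_left)
  moreover have "?n * c\<^sup>2 - 2 * c * ?S + ?S\<^sup>2 / ?n = (?n * c - ?S)\<^sup>2 / ?n"
    using n by (simp add: field_simps power2_eq_square)
  moreover have "0 \<le> (?n * c - ?S)\<^sup>2 / ?n" by simp
  ultimately show ?thesis unfolding sum_sq_dev_def by linarith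
qed simp

definition cell_potential :: "(nat \<Rightarrow> real) \<Rightarrow> nat set \<Rightarrow> real" where
  "cell_potential y A = sum_sq_dev y A + harm (card A)"

text \<open>Adding a point at distance \<open>\<delta>\<close> from the mean of \<open>n\<close> points increases the sum of squared
  deviations by \<open>n / (n + 1) * \<delta>\<^sup>2\<close>; the harmonic term pays for the missing \<open>\<delta>\<^sup>2 / (n + 1)\<close>.\<close>

lemma predict_loss_le:
  assumes fin: "finite (cell st s)" and t: "t \<notin> cell st s"
    and y: "y t \<in> {0..1}" "\<And>t'. t' \<in> cell st s \<Longrightarrow> y t' \<in> {0..1}"
  shows "(predict y st s - y t)\<^sup>2 \<le> cell_potential y (insert t (cell st s)) - cell_potential y (cell st s)"
proof (cases "cell st s = {}")
  case True
  \<comment> \<open>In an empty cell the deviation stays 0 and the harmonic term rises from 0 to 1,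
    so the crude bound 1 on the loss suffices.\<close>
  have "\<bar>1 / 2 - y t\<bar> \<le> 1" using y(1) by auto
  then have "(1 / 2 - y t)\<^sup>2 \<le> 1" by (simp add: abs_square_le_1)
  then show ?thesis using True by (simp add: predict_def cell_potential_def sum_sq_dev_def harm_expand)
next
  case False
  let ?n = "real (card (cell st s))" and ?S = "\<Sum>t'\<in>cell st s. y t'"
  have n: "0 < ?n" using False fin by (simp add: card_gt_0_iff)
  have "?S \<le> ?n * 1" using y(2) by (intro sum_bounded_above) auto
  moreover have "0 \<le> ?S" using y(2) by (intro sum_nonneg) auto
  ultimately have "?S / ?n \<in> {0..1}" using n by simp
  then have "\<bar>?S / ?n - y t\<bar> \<le> 1" using y(1) by (auto simp: abs_le_iff)
  then have le1: "(?S / ?n - y t)\<^sup>2 \<le> 1" by (simp add: abs_square_le_1)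
  have "sum_sq_dev y (insert t (cell st s)) - sum_sq_dev y (cell st s)
      = (y t)\<^sup>2 - (y t + ?S)\<^sup>2 / (1 + ?n) + ?S\<^sup>2 / ?n"
    using fin t by (simp add: sum_sq_dev_def)
  also have "\<dots> = (?S / ?n - y t)\<^sup>2 - (?S / ?n - y t)\<^sup>2 / (1 + ?n)"
    using n by (simp add: divide_simps) (simp add: algebra_simps power2_eq_square)
  finally have "sum_sq_dev y (insert t (cell st s)) - sum_sq_dev y (cell st s)
      = (?S / ?n - y t)\<^sup>2 - (?S / ?n - y t)\<^sup>2 / (1 + ?n)" .
  moreover have "(?S / ?n - y t)\<^sup>2 / (1 + ?n) \<le> 1 / (1 + ?n)"
    using le1 n by (intro divide_right_mono) auto
  ultimately show ?thesis
    using False fin t by (simp add: predict_def cell_potential_def harm_Suc inverse_eq_divide)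
qed

text \<open>For the rounds that open a new center: their label enters no cell, so the loss is
  charged to the center itself.\<close>

lemma predict_loss_le_1:
  assumes "y t \<in> {0..1}" "\<And>t'. t' \<in> cell st s \<Longrightarrow> y t' \<in> {0..1}"
  shows "(predict y st s - y t)\<^sup>2 \<le> 1"
proof -
  have "predict y st s \<in> {0..1}"
  \<comment> \<open>For an infinite cell both sum and cardinality are 0 by convention, so the
    prediction is 0.\<close>
  proof (cases "cell st s = {} \<or> infinite (cell st s)")
    case False
    then have "0 < real (card (cell st s))" by (simp add: card_gt_0_iff)
    moreover have "(\<Sum>t'\<in>cell st s. y t') \<le> real (card (cell st s)) * 1"
      using assms(2) by (intro sum_bounded_above) auto
    moreover have "0 \<le> (\<Sum>t'\<in>cell st s. y t')" using assms(2) by (intro sum_nonneg) auto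
    ultimately show ?thesis using False by (simp add: predict_def)
  qed (auto simp: predict_def)
  then have "\<bar>predict y st s - y t\<bar> \<le> 1" using assms(1) by (auto simp: abs_le_iff)
  then show ?thesis by (simp add: abs_square_le_1)
qed

text \<open>Two bounds are needed because, within round \<open>n + 1\<close>, the index \<open>n + 1\<close> may be a center
  before it belongs to a cell.\<close>

definition cell_invariant ::
    "(nat \<Rightarrow> real) \<Rightarrow> real^'d^'d \<Rightarrow> (nat \<Rightarrow> real^'d) \<Rightarrow> nat \<Rightarrow> nat \<Rightarrow> nn_state \<Rightarrow> bool" where
  "cell_invariant eps M x m n st \<longleftrightarrow>
     centers st \<subseteq> {1..m} \<and>
     (\<forall>s\<in>centers st. \<forall>t\<in>cell st s. t \<in> {1..n} \<and> mnorm M (x t - x s) \<le> eps t) \<and>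
     (\<forall>s\<in>centers st. \<forall>s'\<in>centers st. s < s' \<longrightarrow> eps s' < mnorm M (x s' - x s)) \<and>
     disjoint_family_on (cell st) (centers st)"

lemma cell_invariant_finite:
  assumes "cell_invariant eps M x m n st"
  shows "finite (centers st)" "s \<in> centers st \<Longrightarrow> finite (cell st s)"
proof -
  show "finite (centers st)"
    using assms finite_subset[of "centers st" "{1..m}"] by (simp add: cell_invariant_def)
  assume "s \<in> centers st"
  then have "cell st s \<subseteq> {1..n}" using assms by (auto simp: cell_invariant_def)
  then show "finite (cell st s)" by (rule finite_subset) simp
qed

lemma cell_invariant_ensure_center:
  assumes "cell_invariant eps M x n n st"
  shows "cell_invariant eps M x (Suc n) n (ensure_center (Suc n) st)"
proof (cases "centers st = {}")
  case False
  have "{1..n} \<subseteq> {1..Suc n}" by auto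
  with assms False show ?thesis
    unfolding cell_invariant_def ensure_center_def by (simp only: if_False) blast
qed (simp add: cell_invariant_def ensure_center_def disjoint_family_on_def)

text \<open>If \<open>t\<close> were a center, the minimal distance would be 0, and no new center would be opened.\<close>

lemma new_center_fresh:
  assumes sel: "is_arg_min (\<lambda>s. mnorm M (x t - x s)) (\<lambda>s. s \<in> centers st) s"
    and eps: "0 \<le> eps t" and far: "\<not> mnorm M (x t - x s) \<le> eps t"
  shows "t \<notin> centers st"
proof
  assume "t \<in> centers st"
  then have "mnorm M (x t - x s) \<le> mnorm M (x t - x t)"
    using sel unfolding is_arg_min_linorder by blast
  moreover have "mnorm M (x t - x t) = 0" by (simp add: mnorm_def)
  ultimately show False using eps far by linarith
qed

text \<open>A center is opened only if even the nearest one is further than the current radius,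
  hence all are. This is why separation of a pair is measured by the radius of the later index.
  Disjointness persists because the current index lies in no cell yet.\<close>

lemma cell_invariant_update:
  assumes inv: "cell_invariant eps M x (Suc n) n st"
    and sel: "is_arg_min (\<lambda>s. mnorm M (x (Suc n) - x s)) (\<lambda>s. s \<in> centers st) s"
    and eps: "0 \<le> eps (Suc n)"
  shows "cell_invariant eps M x (Suc n) (Suc n) (update eps M x (Suc n) s st)"
proof -
  have s: "s \<in> centers st" and min: "\<And>s'. s' \<in> centers st \<Longrightarrow>
      mnorm M (x (Suc n) - x s) \<le> mnorm M (x (Suc n) - x s')"
    using sel by (auto simp: is_arg_min_linorder)
  have cell: "t \<in> {1..n}" "mnorm M (x t - x s') \<le> eps t" if "s' \<in> centers st" "t \<in> cell st s'" for s' t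
    using inv that by (auto simp: cell_invariant_def)
  have new: "Suc n \<notin> cell st s'" if "s' \<in> centers st" for s'
    using cell(1)[OF that, of "Suc n"] by auto
  have cen: "centers st \<subseteq> {1..Suc n}"
    and sep: "\<And>s s'. s \<in> centers st \<Longrightarrow> s' \<in> centers st \<Longrightarrow> s < s' \<Longrightarrow> eps s' < mnorm M (x s' - x s)"
    and disj: "\<And>s s'. s \<in> centers st \<Longrightarrow> s' \<in> centers st \<Longrightarrow> s \<noteq> s' \<Longrightarrow> cell st s \<inter> cell st s' = {}"
    using inv by (auto simp: cell_invariant_def disjoint_family_on_def)
  show ?thesis
  proof (cases "mnorm M (x (Suc n) - x s) \<le> eps (Suc n)")
    case True
    let ?st = "st\<lparr>cell := (cell st)(s := cell st s \<union> {Suc n})\<rparr>"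
    have "t \<in> {1..Suc n} \<and> mnorm M (x t - x s') \<le> eps t"
      if "s' \<in> centers st" "t \<in> cell ?st s'" for s' t
      using that True cell[of s' t] by (auto split: if_splits)
    moreover have "disjoint_family_on (cell ?st) (centers st)"
      unfolding disjoint_family_on_def using disj new s by (auto split: if_splits)
    ultimately show ?thesis
      using True cen sep by (simp add: update_def cell_invariant_def)
  next
    case False
    have fresh: "Suc n \<notin> centers st" using new_center_fresh[where eps=eps, OF sel eps False] .
    let ?st = "\<lparr>centers = centers st \<union> {Suc n}, cell = (cell st)(Suc n := {})\<rparr>"
    have "t \<in> {1..Suc n} \<and> mnorm M (x t - x s') \<le> eps t"
      if "s' \<in> centers ?st" "t \<in> cell ?st s'" for s' t
    proof -
      have "s' \<in> centers st" "t \<in> cell st s'" using that by (auto split: if_splits)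
      then show ?thesis using cell[of s' t] by auto
    qed
    moreover have "disjoint_family_on (cell ?st) (centers ?st)"
      unfolding disjoint_family_on_def using disj by (auto split: if_splits)
    moreover have "eps b < mnorm M (x b - x a)"
      if ab: "a \<in> centers ?st" "b \<in> centers ?st" "a < b" for a b
    proof (cases "b = Suc n")
      case True
      then have "a \<in> centers st" using ab by auto
      then show ?thesis using min[of a] False True by simp
    next
      case bn: False
      then have b: "b \<in> centers st" using ab by auto
      then have "b \<le> Suc n" using cen by auto
      then have "a \<in> centers st" using ab by auto
      then show ?thesis using sep b ab(3) by blast
    qed
    ultimately show ?thesis
      using False cen unfolding cell_invariant_def by (simp add: update_def)
  qed
qed

lemma valid_selectionD:
  assumes "valid_selection eps M x sel"
  shows "is_arg_min (\<lambda>s. mnorm M (x (Suc n) - x s))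
    (\<lambda>s. s \<in> centers (ensure_center (Suc n) (state_after eps M x sel n))) (sel (Suc n))"
  using assms unfolding valid_selection_def state_in_def by (metis diff_Suc_1 le_add1 plus_1_eq_Suc)

lemma cell_invariant_state_after:
  assumes sel: "valid_selection eps M x sel" and eps: "\<And>t. 1 \<le> t \<Longrightarrow> 0 \<le> eps t"
  shows "cell_invariant eps M x n n (state_after eps M x sel n)"
proof (induction n)
  case 0
  show ?case by (simp add: cell_invariant_def disjoint_family_on_def)
next
  case (Suc n)
  from cell_invariant_update[OF cell_invariant_ensure_center[OF Suc] valid_selectionD[OF sel]] eps
  show ?case by simp
qed

text \<open>A bound on the cumulative loss that is read off the state: one unit per center for the
  round that opened it, plus what the cells account for.\<close>

definition state_potential :: "(nat \<Rightarrow> real) \<Rightarrow> nn_state \<Rightarrow> real" where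
  "state_potential y st = real (card (centers st)) + (\<Sum>s\<in>centers st. cell_potential y (cell st s))"

lemma state_potential_ensure_center:
  "state_potential y st \<le> state_potential y (ensure_center t st)"
  by (simp add: state_potential_def ensure_center_def cell_potential_def harm_expand)

lemma state_potential_update:
  assumes inv: "cell_invariant eps M x (Suc n) n st"
    and sel: "is_arg_min (\<lambda>s. mnorm M (x (Suc n) - x s)) (\<lambda>s. s \<in> centers st) s"
    and eps: "0 \<le> eps (Suc n)" and y: "\<And>t. 1 \<le> t \<Longrightarrow> y t \<in> {0..1}"
  shows "(predict y st s - y (Suc n))\<^sup>2 + state_potential y st
    \<le> state_potential y (update eps M x (Suc n) s st)"
proof -
  have s: "s \<in> centers st" using sel by (simp add: is_arg_min_def)
  note fin = cell_invariant_finite[OF inv]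
  have cell: "t \<in> {1..n}" if "t \<in> cell st s" for t
    using inv s that by (auto simp: cell_invariant_def)
  have new: "Suc n \<notin> cell st s" using cell[of "Suc n"] by auto
  have ycell: "y t \<in> {0..1}" if "t \<in> cell st s" for t using y cell[OF that] by auto
  show ?thesis
  proof (cases "mnorm M (x (Suc n) - x s) \<le> eps (Suc n)")
    case True
    have "(\<Sum>s'\<in>centers st. cell_potential y (((cell st)(s := insert (Suc n) (cell st s))) s'))
        = cell_potential y (insert (Suc n) (cell st s))
          + (\<Sum>s'\<in>centers st - {s}. cell_potential y (cell st s'))"
      by (subst sum.remove[OF fin(1) s]) (auto intro!: sum.cong)
    moreover have "(\<Sum>s'\<in>centers st. cell_potential y (cell st s'))
        = cell_potential y (cell st s) + (\<Sum>s'\<in>centers st - {s}. cell_potential y (cell st s'))"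
      by (rule sum.remove[OF fin(1) s])
    ultimately show ?thesis
      using predict_loss_le[of st s "Suc n" y, OF fin(2)[OF s] new _ ycell] y[of "Suc n"] True
      by (simp add: update_def state_potential_def)
  next
    case False
    have fresh: "Suc n \<notin> centers st" using new_center_fresh[where eps=eps, OF sel eps False] .
    \<comment> \<open>Freshness ensures that emptying the cell at \<open>Suc n\<close> erases no
      existing cell.\<close>
    have "(\<Sum>s'\<in>centers st. cell_potential y (((cell st)(Suc n := {})) s'))
        = (\<Sum>s'\<in>centers st. cell_potential y (cell st s'))"
      using fresh by (intro sum.cong) auto
    then show ?thesis
      using predict_loss_le_1[of y "Suc n" st s] y ycell False fresh fin(1)
      by (simp add: update_def state_potential_def cell_potential_def harm_expand)
  qed
qed

lemma total_loss_le_potential: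
  assumes sel: "valid_selection eps M x sel" and eps: "\<And>t. 1 \<le> t \<Longrightarrow> 0 \<le> eps t"
    and y: "\<And>t. 1 \<le> t \<Longrightarrow> y t \<in> {0..1}"
  shows "(\<Sum>t=1..n. (prediction eps M x y sel t - y t)\<^sup>2) \<le> state_potential y (state_after eps M x sel n)"
proof (induction n)
  case 0
  show ?case by (simp add: state_potential_def)
next
  case (Suc n)
  let ?st = "state_after eps M x sel n"
  have "(prediction eps M x y sel (Suc n) - y (Suc n))\<^sup>2 + state_potential y (ensure_center (Suc n) ?st)
      \<le> state_potential y (state_after eps M x sel (Suc n))"
    using state_potential_update[OF cell_invariant_ensure_center[OF cell_invariant_state_after[OF sel eps]]
        valid_selectionD[OF sel], of n y] eps y
    by (simp add: prediction_def state_in_def)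
  then show ?case
    using Suc.IH state_potential_ensure_center[of y ?st "Suc n"] by simp
qed

section \<open>From the potential to the regret\<close>

lemma harm_le_1_plus_ln: "1 \<le> n \<Longrightarrow> harm n \<le> 1 + ln (real n)"
  using euler_mascheroni_sequence_decreasing[of 1 n] by (simp add: harm_expand)

text \<open>Only an inequality, because rounds that opened a center by distance belong to no cell;
  this is where \<open>h\<close> must be nonnegative.\<close>

lemma sum_cells_le:
  fixes h :: "nat \<Rightarrow> real"
  assumes inv: "cell_invariant eps M x m n st" and h: "\<And>t. t \<in> {1..n} \<Longrightarrow> 0 \<le> h t"
  shows "(\<Sum>s\<in>centers st. \<Sum>t\<in>cell st s. h t) \<le> (\<Sum>t=1..n. h t)"
proof -
  note fin = cell_invariant_finite[OF inv]
  have "(\<Sum>s\<in>centers st. \<Sum>t\<in>cell st s. h t) = sum h (\<Union>s\<in>centers st. cell st s)"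
    using fin inv unfolding cell_invariant_def disjoint_family_on_def
    by (intro sum.UNION_disjoint[symmetric]) auto
  also have "\<dots> \<le> (\<Sum>t=1..n. h t)"
    using inv h by (intro sum_mono2) (auto simp: cell_invariant_def)
  finally show ?thesis .
qed

lemma square_loss_diff_le:
  fixes a b z :: real
  assumes "a \<in> {0..1}" "b \<in> {0..1}" "z \<in> {0..1}"
  shows "(a - z)\<^sup>2 \<le> (b - z)\<^sup>2 + 2 * \<bar>a - b\<bar>"
proof -
  have "(a - z)\<^sup>2 - (b - z)\<^sup>2 = (a - b) * (a + b - 2 * z)"
    by (simp add: power2_eq_square algebra_simps)
  also have "\<dots> \<le> \<bar>a - b\<bar> * \<bar>a + b - 2 * z\<bar>"
    by (metis abs_ge_self abs_mult)
  also have "\<dots> \<le> \<bar>a - b\<bar> * 2"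
    using assms by (intro mult_left_mono) auto
  finally show ?thesis by simp
qed

text \<open>In the cell of \<open>s\<close> the comparator is the constant \<open>f (x s)\<close>;
  replacing it by \<open>f (x t)\<close> costs \<open>2 * L * eps t\<close>, as the square loss is
  2-Lipschitz on the unit interval. Each center pays 1 for being opened and \<open>1 + ln T\<close>
  for its harmonic term.\<close>

lemma regret_le_centers:
  fixes f :: "real^'d \<Rightarrow> real"
  assumes sel: "valid_selection eps M x sel" and eps: "\<And>t. 1 \<le> t \<Longrightarrow> 0 \<le> eps t"
    and x: "\<And>t. 1 \<le> t \<Longrightarrow> x t \<in> B" and y: "\<And>t. 1 \<le> t \<Longrightarrow> y t \<in> {0..1}"
    and f: "\<And>a. a \<in> B \<Longrightarrow> f a \<in> {0..1}"
    and L: "0 \<le> L" "\<And>a b. a \<in> B \<Longrightarrow> b \<in> B \<Longrightarrow> \<bar>f a - f b\<bar> \<le> L * mnorm M (a - b)"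
    and T: "1 \<le> T"
  shows "regret (prediction eps M x y sel) x y f T
    \<le> real (card (centers (state_after eps M x sel T))) * (2 + ln (real T)) + 2 * L * (\<Sum>t=1..T. eps t)"
proof -
  define st where "st = state_after eps M x sel T"
  have inv: "cell_invariant eps M x T T st"
    unfolding st_def by (rule cell_invariant_state_after[OF sel eps])
  note fin = cell_invariant_finite[OF inv]
  have potential: "cell_potential y (cell st s)
      \<le> (\<Sum>t\<in>cell st s. (f (x t) - y t)\<^sup>2 + 2 * L * eps t) + (1 + ln (real T))"
    if s: "s \<in> centers st" for s
  proof -
    have cell: "cell st s \<subseteq> {1..T}" using inv s by (auto simp: cell_invariant_def)
    have "card (cell st s) \<le> T" using card_mono[OF _ cell] by simp
    then have "harm (card (cell st s)) \<le> (harm T :: real)" by (rule harm_mono)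
    also have "\<dots> \<le> 1 + ln (real T)" using T by (rule harm_le_1_plus_ln)
    finally have "harm (card (cell st s)) \<le> 1 + ln (real T)" .
    moreover have "sum_sq_dev y (cell st s) \<le> (\<Sum>t\<in>cell st s. (f (x s) - y t)\<^sup>2)"
      using fin(2)[OF s] by (rule sum_sq_dev_le)
    moreover have "\<dots> \<le> (\<Sum>t\<in>cell st s. (f (x t) - y t)\<^sup>2 + 2 * L * eps t)"
    proof (rule sum_mono)
      fix t assume t: "t \<in> cell st s"
      have "1 \<le> t" "1 \<le> s" and near: "mnorm M (x t - x s) \<le> eps t"
        using inv s t by (auto simp: cell_invariant_def)
      then have xs: "x t \<in> B" "x s \<in> B" and yt: "y t \<in> {0..1}" using x y by auto
      have "\<bar>f (x t) - f (x s)\<bar> \<le> L * mnorm M (x t - x s)" using L(2) xs by blast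
      also have "\<dots> \<le> L * eps t" using near L(1) by (rule mult_left_mono)
      finally have "2 * \<bar>f (x s) - f (x t)\<bar> \<le> 2 * L * eps t"
        by (simp add: abs_minus_commute)
      then show "(f (x s) - y t)\<^sup>2 \<le> (f (x t) - y t)\<^sup>2 + 2 * L * eps t"
        using square_loss_diff_le[OF f[OF xs(2)] f[OF xs(1)] yt] by linarith
    qed
    ultimately show ?thesis unfolding cell_potential_def by linarith
  qed
  have "(\<Sum>t=1..T. (prediction eps M x y sel t - y t)\<^sup>2) \<le> state_potential y st"
    unfolding st_def by (rule total_loss_le_potential[OF sel eps y])
  also have "\<dots> \<le> real (card (centers st)) + (\<Sum>s\<in>centers st.
      (\<Sum>t\<in>cell st s. (f (x t) - y t)\<^sup>2 + 2 * L * eps t) + (1 + ln (real T)))"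
    unfolding state_potential_def using potential by (intro add_left_mono sum_mono)
  also have "\<dots> = real (card (centers st)) * (2 + ln (real T))
      + (\<Sum>s\<in>centers st. \<Sum>t\<in>cell st s. (f (x t) - y t)\<^sup>2 + 2 * L * eps t)"
    by (subst sum.distrib) (simp add: algebra_simps)
  also have "\<dots> \<le> real (card (centers st)) * (2 + ln (real T))
      + (\<Sum>t=1..T. (f (x t) - y t)\<^sup>2 + 2 * L * eps t)"
    using eps L(1) by (intro add_left_mono sum_cells_le[OF inv]) auto
  also have "\<dots> = real (card (centers st)) * (2 + ln (real T))
      + (\<Sum>t=1..T. (f (x t) - y t)\<^sup>2) + 2 * L * (\<Sum>t=1..T. eps t)"
    by (simp add: sum.distrib sum_distrib_left)
  finally show ?thesis by (simp add: regret_def sum_subtractf st_def)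
qed

subsection \<open>The regret bound\<close>

lemma normalized_eigensystem_spectrum:
  assumes "normalized_eigensystem (M :: real^'d^'d) u lam"
  shows "normalized_spectrum CARD('d) lam"
proof
  show "0 < lam i" if "i \<in> {1..CARD('d)}" for i using eigenvalue_bounds(1)[OF assms that] .
  show "lam 1 = 1" using assms by (simp only: normalized_eigensystem_def)
  show "lam j \<le> lam i" if "1 \<le> i" "i \<le> j" "j \<le> CARD('d)" for i j
    using assms that by (simp add: normalized_eigensystem_def)
  show "1 \<le> CARD('d)" by (simp add: Suc_le_eq)
qed

lemma card_centers_le:
  fixes M :: "real^'d^'d"
  defines "eps \<equiv> radius CARD('d)"
  assumes E: "normalized_eigensystem M u lam" and sel: "valid_selection (eps lam) M x sel"
    and x: "\<And>t. 1 \<le> t \<Longrightarrow> x t \<in> cball 0 1" and T: "1 \<le> T"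
    and R: "R = effective_rank CARD('d) lam T"
  shows "real (card (centers (state_after (eps lam) M x sel T)))
    \<le> (2 * sqrt (real CARD('d)) + 2) ^ CARD('d) *
      (sqrt (truncated_det lam (kappa CARD('d) lam R T)) * real T powr (real R / (1 + real R)))"
proof -
  interpret normalized_spectrum "CARD('d)" lam using normalized_eigensystem_spectrum[OF E] .
  define S where "S = centers (state_after (eps lam) M x sel T)"
  have pos: "0 < eps lam t" if "1 \<le> t" for t using that by (simp add: eps_def radius_def)
  then have inv: "cell_invariant (eps lam) M x T T (state_after (eps lam) M x sel T)"
    by (intro cell_invariant_state_after[OF sel]) (auto intro: less_imp_le)
  have S: "S \<subseteq> {1..T}" using inv by (simp add: S_def cell_invariant_def)
  \<comment> \<open>The smallest radius may occur before \<open>T\<close>;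
    \<open>ellipsoid_volume_bound\<close> holds at every round, so the minimizer can be
    used.\<close>
  obtain t where t: "t \<in> {1..T}" and min: "\<And>s. s \<in> {1..T} \<Longrightarrow> eps lam t \<le> eps lam s"
    using T ex_min_if_finite[of "eps lam ` {1..T}"] by force
  have "real (card S) \<le> (2 * sqrt (real CARD('d)) + 2) ^ CARD('d) *
           (\<Prod>i=1..CARD('d). max 1 (sqrt (lam i) / eps lam t))"
  proof (rule packing_bound[OF E])
    show "0 < eps lam t" using pos t by simp
    show "x s \<in> cball 0 1" if "s \<in> S" for s using x that S by auto
    have less: "eps lam t < mnorm M (x s' - x s)" if "s \<in> S" "s' \<in> S" "s < s'" for s s'
    proof -
      have "eps lam s' < mnorm M (x s' - x s)"
        using inv that by (simp add: cell_invariant_def S_def)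
      moreover have "eps lam t \<le> eps lam s'" using min that S by blast
      ultimately show ?thesis by simp
    qed
    show "eps lam t < mnorm M (x s - x s')" if "s \<in> S" "s' \<in> S" "s \<noteq> s'" for s s'
      using less[of s s'] less[of s' s] that by (cases "s < s'") (auto simp: mnorm_minus_commute)
  qed
  also have "\<dots> \<le> (2 * sqrt (real CARD('d)) + 2) ^ CARD('d) *
      (sqrt (truncated_det lam (kappa CARD('d) lam R T)) * real T powr (real R / (1 + real R)))"
    using t unfolding eps_def by (intro mult_left_mono ellipsoid_volume_bound R) auto
  finally show ?thesis by (simp add: S_def)
qed

lemma grad_le_grad_sup_norm:
  assumes "norm v = 1" "z \<in> cball 0 1"
  shows "ereal \<bar>grad f z \<bullet> v\<bar> \<le> grad_sup_norm v f"
proof -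
  \<comment> \<open>Both unit vectors of the line enter the supremum, which yields the absolute
    value.\<close>
  have "ereal (grad f z \<bullet> w) \<le> grad_sup_norm v f" if "w \<in> {v, - v}" for w
  proof -
    have "w \<in> {w \<in> span {v}. norm w = 1}"
      using that assms(1) by (auto intro: span_base span_neg)
    then show ?thesis
      unfolding grad_sup_norm_def using assms(2) by (intro SUP_upper2[of w] SUP_upper2[of z]) auto
  qed
  from this[of v] this[of "- v"] show ?thesis by (cases "0 \<le> grad f z \<bullet> v") auto
qed

lemma regret_bound_real:
  fixes M :: "real^'d^'d" and f :: "real^'d \<Rightarrow> real"
  assumes E: "normalized_eigensystem M u lam"
    and xy: "\<And>t. 1 \<le> t \<Longrightarrow> x t \<in> cball 0 1 \<and> y t \<in> {0..1}"
    and sel: "valid_selection (radius CARD('d) lam) M x sel" and T: "1 \<le> T"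
    and f: "f ` cball 0 1 \<subseteq> {0..1}" "f differentiable_on cball 0 1"
    and g: "\<And>i z. i \<in> {1..CARD('d)} \<Longrightarrow> z \<in> cball 0 1 \<Longrightarrow> \<bar>grad f z \<bullet> u i\<bar> \<le> g i"
    and R: "R = effective_rank CARD('d) lam T"
  shows "regret (prediction (radius CARD('d) lam) M x y sel) x y f T
    \<le> (4 + 2 * (2 * sqrt (real CARD('d)) + 2) ^ CARD('d)) * (1 + ln (real T)) *
      (sqrt (truncated_det lam (kappa CARD('d) lam R T)) +
       sqrt (\<Sum>i=1..CARD('d). (g i)\<^sup>2 / lam i)) *
      real T powr (real R / (1 + real R))"
proof -
  interpret normalized_spectrum "CARD('d)" lam using normalized_eigensystem_spectrum[OF E] .
  define L where "L = sqrt (\<Sum>i=1..CARD('d). (g i)\<^sup>2 / lam i)"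
  define D where "D = sqrt (truncated_det lam (kappa CARD('d) lam R T))"
  define P where "P = (2 * sqrt (real CARD('d)) + 2) ^ CARD('d)"
  define Q where "Q = real T powr (real R / (1 + real R))"
  define l where "l = ln (real T)"
  have nonneg: "0 \<le> L" "0 \<le> D" "0 \<le> P" "0 \<le> Q" "0 \<le> l"
  proof -
    show "0 \<le> L" unfolding L_def using pos
      by (intro real_sqrt_ge_zero sum_nonneg divide_nonneg_nonneg) (auto simp: less_imp_le)
    have "0 \<le> lam i" if "i \<in> {1..kappa CARD('d) lam R T}" for i
      using pos[of i] kappa_props(1)[OF T, of R] that by auto
    then show "0 \<le> D" unfolding D_def truncated_det_def
      by (intro real_sqrt_ge_zero prod_nonneg) auto
  qed (use T in \<open>auto simp: P_def Q_def l_def\<close>)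
  have "regret (prediction (radius CARD('d) lam) M x y sel) x y f T
    \<le> real (card (centers (state_after (radius CARD('d) lam) M x sel T))) * (2 + l)
      + 2 * L * (\<Sum>t=1..T. radius CARD('d) lam t)"
    unfolding l_def
  proof (rule regret_le_centers[OF sel _ _ _ _ _ _ T, where B = "cball 0 1"])
    show "\<bar>f a - f b\<bar> \<le> L * mnorm M (a - b)" if "a \<in> cball 0 1" "b \<in> cball 0 1" for a b
      unfolding L_def using lipschitz_mnorm[OF E f(2) g that] .
    show "f a \<in> {0..1}" if "a \<in> cball 0 1" for a using f(1) that by blast
  qed (use xy nonneg in \<open>auto simp: radius_def\<close>)
  also have "\<dots> \<le> (P * (D * Q)) * (2 + l) + 2 * L * (2 * Q)"
    unfolding P_def D_def Q_def
    using nonneg card_centers_le[OF E sel _ T R] xy sum_radius_le[OF T R]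
    by (intro add_mono mult_left_mono mult_right_mono) auto
  also have "\<dots> \<le> (4 + 2 * P) * (1 + l) * (D + L) * Q"
  proof -
    \<comment> \<open>This sum is exactly the right side minus the left side, expanded.\<close>
    have "0 \<le> P * D * Q * l + 4 * D * Q * (1 + l) + 4 * L * Q * l + 2 * P * (1 + l) * L * Q"
      using nonneg by (intro add_nonneg_nonneg mult_nonneg_nonneg) auto
    then show ?thesis by (simp add: algebra_simps)
  qed
  finally show ?thesis by (simp add: P_def D_def Q_def L_def l_def)
qed

theorem theorem1:
  shows "\<exists>(C::real) (p::nat). C > 0 \<and> (
    \<forall>(M :: real^'d^'d) (u :: nat \<Rightarrow> real^'d) (lam :: nat \<Rightarrow> real)
     (x :: nat \<Rightarrow> real^'d) (y :: nat \<Rightarrow> real) (sel :: nat \<Rightarrow> nat) (T :: nat) (f :: real^'d \<Rightarrow> real).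
      positive_definite M \<longrightarrow> normalized_eigensystem M u lam \<longrightarrow>
      (\<forall>t\<ge>1. x t \<in> cball 0 1 \<and> y t \<in> {0..1}) \<longrightarrow>
      valid_selection (radius CARD('d) lam) M x sel \<longrightarrow>
      T \<ge> 1 \<longrightarrow>
      f ` cball 0 1 \<subseteq> {0..1} \<longrightarrow> f differentiable_on cball 0 1 \<longrightarrow>
      (let rho = effective_rank CARD('d) lam T;
           kap = kappa CARD('d) lam rho T
       in kap \<le> rho \<and> rho \<le> CARD('d) \<and>
          ereal (regret (prediction (radius CARD('d) lam) M x y sel) x y f T)
          \<le> ereal (C * (1 + ln (real T)) ^ p) *
            (ereal (sqrt (truncated_det lam kap)) +
             ereal_sqrt (\<Sum>i=1..CARD('d). (grad_sup_norm (u i) f)\<^sup>2 / ereal (lam i))) *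
            ereal (real T powr (real rho / (1 + real rho)))))"
proof -
  let ?P = "(2 * sqrt (real CARD('d)) + 2) ^ CARD('d)"
  have "ereal (regret (prediction (radius CARD('d) lam) M x y sel) x y f T)
      \<le> ereal ((4 + 2 * ?P) * (1 + ln (real T)) ^ 1) *
        (ereal (sqrt (truncated_det lam (kappa CARD('d) lam R T))) +
         ereal_sqrt (\<Sum>i=1..CARD('d). (grad_sup_norm (u i) f)\<^sup>2 / ereal (lam i))) *
        ereal (real T powr (real R / (1 + real R)))"
    if E: "normalized_eigensystem M u lam"
      and xy: "\<forall>t\<ge>1. x t \<in> cball 0 1 \<and> y t \<in> {0..1}"
      and sel: "valid_selection (radius CARD('d) lam) M x sel" and T: "1 \<le> T"
      and f: "f ` cball 0 1 \<subseteq> {0..1}" "f differentiable_on cball 0 1"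
      and R: "R = effective_rank CARD('d) lam T"
    for M :: "real^'d^'d" and u lam x y sel T f R
  proof -
    let ?I = "{1..CARD('d)}" and ?N = "\<lambda>i. grad_sup_norm (u i) f"
    \<comment> \<open>Strict positivity matters for infinite gradients: a zero prefactor times
      infinity would be 0 in \<open>ereal\<close>.\<close>
    have C: "0 < (4 + 2 * ?P) * (1 + ln (real T))"
      using T by (intro mult_pos_pos add_pos_nonneg) auto
    have lam: "0 < lam i" if "i \<in> ?I" for i using eigenvalue_bounds(1)[OF E that] .
    have grad_le: "ereal \<bar>grad f z \<bullet> u i\<bar> \<le> ?N i" if "i \<in> ?I" "z \<in> cball 0 1" for i z
    proof (rule grad_le_grad_sup_norm[OF _ that(2)])
      show "norm (u i) = 1"
        using E that(1) by (auto simp: normalized_eigensystem_def norm_eq_sqrt_inner)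
    qed
    have N0: "0 \<le> ?N i" if "i \<in> ?I" for i
      using order_trans[OF _ grad_le[OF that, of 0]] by simp
    show ?thesis
    \<comment> \<open>An unbounded directional derivative makes the right side infinite; otherwise
      all norms are real and \<open>regret_bound_real\<close> applies.\<close>
    proof (cases "\<exists>i\<in>?I. ?N i = \<infinity>")
      case True
      then obtain i where "i \<in> ?I" "?N i = \<infinity>" by blast
      then have "(?N i)\<^sup>2 / ereal (lam i) = \<infinity>"
        using lam[of i] by (simp add: power2_eq_square)
      then have "(\<Sum>i\<in>?I. (?N i)\<^sup>2 / ereal (lam i)) = \<infinity>"
        using \<open>i \<in> ?I\<close> by (subst sum_Pinfty) blast
      then show ?thesis using C C[THEN less_imp_neq] T by (simp add: ereal_sqrt_def)
    next
      case False
      define g where "g i = real_of_ereal (?N i)" for i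
      have N: "?N i = ereal (g i)" if "i \<in> ?I" for i
        using N0[OF that] False that by (cases "?N i") (auto simp: g_def)
      have "(\<Sum>i\<in>?I. (?N i)\<^sup>2 / ereal (lam i)) = (\<Sum>i\<in>?I. ereal ((g i)\<^sup>2 / lam i))"
        using N lam by (intro sum.cong refl) (force simp: power2_eq_square)
      then have "ereal_sqrt (\<Sum>i\<in>?I. (?N i)\<^sup>2 / ereal (lam i)) = ereal (sqrt (\<Sum>i\<in>?I. (g i)\<^sup>2 / lam i))"
        by (simp add: ereal_sqrt_def)
      moreover have "\<bar>grad f z \<bullet> u i\<bar> \<le> g i" if "i \<in> ?I" "z \<in> cball 0 1" for i z
        using grad_le[OF that] N[OF that(1)] by simp
      ultimately show ?thesis
        using regret_bound_real[OF E _ sel T f _ R, of y g] xy by simp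
    qed
  qed
  moreover have "kappa CARD('d) lam R T \<le> R \<and> R \<le> CARD('d)"
    if E: "normalized_eigensystem M u lam" and T: "1 \<le> T" and R: "R = effective_rank CARD('d) lam T"
    for M :: "real^'d^'d" and u lam T R
  proof -
    interpret normalized_spectrum "CARD('d)" lam using normalized_eigensystem_spectrum[OF E] .
    show ?thesis using effective_rank_props[OF T] R by simp
  qed
  moreover have "0 < 4 + 2 * ?P" by (intro add_pos_nonneg) auto
  ultimately show ?thesis
    unfolding Let_def by (intro exI[of _ "4 + 2 * ?P"] exI[of _ 1] conjI allI impI) blast+
qed

end
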